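(* Consider the discontinuous Galerkin method (with exact integration) given in the context. Suppose the numerical flux $(T_i^{*m},v_i^{*m})$ is such that, for every mortar element $m$, at every point of $\hat m$ and for all values of the states $v_i^{\pm m},T_i^{\pm m}$ (only the minus states for boundary mortar elements), the following integrands are non-positive: for interior mortar elements $$S_J^m\left((v_i^{-m}-v_i^{+m})T_i^{*m}+v_i^{*m}(T_i^{-m}-T_i^{+m})-v_i^{-m}T_i^{-m}+v_i^{+m}T_i^{+m}\right)\le 0,$$ and for boundary mortar elements $$S_J^m\left(v_i^{-m}T_i^{*m}+v_i^{*m}T_i^{-m}-v_i^{-m}T_i^{-m}\right)\le 0 .$$ Then every solution of the method satisfies the energy estimate $\mathcal E(t)\le\mathcal E(0)$ for $t\ge0$, i.e. the method is energy stable, where $\mathcal E=\sum_{e\in\mathbb E}\mathcal E^e$ and $$\mathcal E^e=\int_{\hat e}J^e\left(\frac{\rho^e}{2}v_i^ev_i^e+\frac12\sigma_{ij}^eS_{ijkl}^e\sigma_{kl}^e\right).$$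
   Context: Conventions: $d\in\{2,3\}$; repeated subscripts $i,j,k,l$ are summed over $1,2,3$; for $d=2$ derivatives in $x_3$ and normal components $n_3$ are zero. Density $\rho>0$ and compliance tensor $S_{ijkl}$ ($S_{ijkl}=S_{klij}=S_{jikl}=S_{ijlk}$, positive definite on symmetric second-order tensors) are time independent, may vary in space and may be discontinuous; superscript $e$ denotes restriction to element $e$. Mesh: $\Omega\subset\mathbb R^d$ is partitioned into a finite set $\mathbb E$ of non-overlapping, possibly curved and nonconforming elements. The mortar $\Gamma=\bigcup_{e\in\mathbb E}\partial e$ is partitioned into a finite set $\mathbb M$ of non-overlapping $(d-1)$-dimensional mortar elements. $\mathbb M^e$ is the set of mortar elements meeting $\partial e$, and $\mathbb E^m$ the set of elements whose boundary meets $m$. Each $m$ has a chosen unit normal $n_i^m$; $\mathbb E^m=\mathbb E^{+m}\cup\mathbb E^{-m}$ (disjoint), where $\mathbb E^{+m}$ are the elements on the side toward which $n^m$ points and $\mathbb E^{-m}$ those on the other side. For boundary mortar elements ($m\subset\partial\Omega$) $n^m$ is outward to $\Omega$ and $\mathbb E^{+m}=\emptyset$. Each $e$ (resp. $m$) is the diffeomorphic image of a reference element $\hat e$ (resp. $\hat m$), with Jacobian determinant $J^e>0$ (resp. surface Jacobian determinant $S_J^m>0$). On $\hat e$, $\partial q/\partial x_j=(\partial r_k^e/\partial x_j)(\partial q/\partial r_k)$, where $r^e$ is the inverse of the element mapping. Spaces and operators: $\hat V^e\subset L^2(\hat e)$ and $\hat U^m\subset L^2(\hat m)$ are finite-dimensional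 approximation spaces (of functions regular enough for the derivatives and integrals below to make sense). For $e\in\mathbb E^m$, $\mathcal P^{m,e}:\hat V^e\to\hat U^m$ is a linear operator (e.g. $L^2$-projection of traces onto the mortar space). For a symmetric tensor $\psi_{ij}\in\hat V^e$, $(n_j\psi_{ij})^{m,e}$ (summed over $j$) denotes either $\mathcal P^{m,e}(n_j^e\psi_{ij})$, with $n^e$ the outward normal of $e$ (and $\mathcal P^{m,e}$ applied to the face values), or $n_j^{m,e}\mathcal P^{m,e}\psi_{ij}$, with $n^{m,e}$ the mortar normal oriented outward to $e$; one choice is fixed throughout. Mortar states: $\phi_i^{m,e}=\mathcal P^{m,e}\phi_i^e$, $v_i^{m,e}=\mathcal P^{m,e}v_i^e$, $T_i^{m,e}=(n_j\sigma_{ij})^{m,e}$, $v_i^{\pm m}=\sum_{e\in\mathbb E^{\pm m}}v_i^{m,e}$, $T_i^{\pm m}=\mp\sum_{e\in\mathbb E^{\pm m}}T_i^{m,e}$; $v_i^{m[e]}=v_i^{\pm m}$ if $e\in\mathbb E^{\pm m}$. A numerical flux is a pair $(T_i^{*m},v_i^{*m})$ determined pointwise on each mortar by the states $v^{\pm m},T^{\pm m}$ (only by the minus states on boundary mortars); $T_i^{*m[e]}=T_i^{*m}$ if $e\in\mathbb E^{-m}$ and $T_i^{*m[e]}=-T_i^{*m}$ if $e\in\mathbb E^{+m}$. Method: for each $e\in\mathbb E$ find (differentiable in $t$) $v_i^e\in\hat V^e$ and symmetric $\sigma_{ij}^e=\sigma_{ji}^e\in\hat V^e$ such that for all $\phi_i^e\in\hat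 V^e$ and all symmetric $\psi_{ij}^e=\psi_{ji}^e\in\hat V^e$ $$\int_{\hat e}J^e\rho^e\phi_i^e\frac{\partial v_i^e}{\partial t}=-\int_{\hat e}J^e\frac{\partial\phi_i^e}{\partial x_j}\sigma_{ij}^e+\sum_{m\in\mathbb M^e}\int_{\hat m}S_J^m\phi_i^{m,e}T_i^{*m[e]},$$ $$\int_{\hat e}J^e\psi_{ij}^eS_{ijkl}^e\frac{\partial\sigma_{kl}^e}{\partial t}=\int_{\hat e}\frac{J^e}{2}\psi_{ij}^e\left(\frac{\partial v_i^e}{\partial x_j}+\frac{\partial v_j^e}{\partial x_i}\right)+\sum_{m\in\mathbb M^e}\int_{\hat m}S_J^m(n_j\psi_{ij})^{m,e}\left(v_i^{*m}-v_i^{m[e]}\right).$$ *)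

theory Defs
  imports "HOL-Analysis.Analysis"
begin

section \<open>Geometry\<close>

text \<open>
  A map is of class C^1 on an arbitrary set if it is the restriction of a C^1 map on an open
  neighbourhood; a diffeomorphism onto the image is C^1 in this sense in both directions.  This
  covers closed d-dimensional elements and (d-1)-dimensional mortar elements alike.
\<close>

definition C1_map_on :: "'a::real_normed_vector set \<Rightarrow> ('a \<Rightarrow> 'b::real_normed_vector) \<Rightarrow> bool" where
  "C1_map_on A f \<longleftrightarrow>
     (\<exists>W g (g' :: 'a \<Rightarrow> 'a \<Rightarrow>\<^sub>L 'b). open W \<and> A \<subseteq> W \<and> (\<forall>x\<in>A. g x = f x) \<and>
        (\<forall>x\<in>W. (g has_derivative blinfun_apply (g' x)) (at x)) \<and> continuous_on W g')"

definition diffeo_on :: "'a::real_normed_vector set \<Rightarrow> ('a \<Rightarrow> 'b::real_normed_vector) \<Rightarrow> bool" where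
  "diffeo_on A f \<longleftrightarrow> inj_on f A \<and> C1_map_on A f \<and> C1_map_on (f ` A) (inv_into A f)"

definition ref_domain :: "'a::euclidean_space set \<Rightarrow> bool" where
  "ref_domain A \<longleftrightarrow> compact A \<and> A \<noteq> {} \<and> closure (interior A) = A \<and> negligible (frontier A)"

text \<open>
  \<open>outward_normal A x \<nu>\<close>: the set \<open>A\<close> has a tangent half space at \<open>x\<close>, with outward unit normal
  \<open>\<nu>\<close>.  Such a \<open>\<nu>\<close> is unique; at corners and edges of \<open>A\<close> there is none.
\<close>

definition outward_normal :: "'a::euclidean_space set \<Rightarrow> 'a \<Rightarrow> 'a \<Rightarrow> bool" where
  "outward_normal A x \<nu> \<longleftrightarrow> norm \<nu> = 1 \<and>
     (\<forall>w. (w \<bullet> \<nu> < 0 \<longrightarrow> (\<forall>\<^sub>F h in at_right 0. x + h *\<^sub>R w \<in> interior A)) \<and>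
          (w \<bullet> \<nu> > 0 \<longrightarrow> (\<forall>\<^sub>F h in at_right 0. x + h *\<^sub>R w \<notin> A)))"

text \<open>
  \<open>'d\<close> indexes the d space coordinates and \<open>'s\<close> the d-1 coordinates of the reference mortar
  elements, whereas vector and tensor indices always run over the three-element type \<open>3\<close>.  The
  numbering \<open>ax\<close> of the space coordinates by \<open>1, 2, 3\<close> links the two; for d = 2 the index \<open>3\<close>
  is not in its range.  Elements and mortar elements are indexed by \<open>'e\<close> and \<open>'q\<close>.
\<close>

record ('d::finite, 's::finite, 'e, 'q) mesh =
  ax :: "'d \<Rightarrow> 3"
  region :: "(real^'d) set"
  elems :: "'e set"
  ref_el :: "'e \<Rightarrow> (real^'d) set"
  el_map :: "'e \<Rightarrow> real^'d \<Rightarrow> real^'d"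
  mortars :: "'q set"
  ref_mo :: "'q \<Rightarrow> (real^'s) set"
  mo_map :: "'q \<Rightarrow> real^'s \<Rightarrow> real^'d"
  mo_normal :: "'q \<Rightarrow> real^'s \<Rightarrow> real^'d"

definition el :: "('d::finite, 's::finite, 'e, 'q, 'z) mesh_scheme \<Rightarrow> 'e \<Rightarrow> (real^'d) set" where
  "el D e = el_map D e ` ref_el D e"

definition mo :: "('d::finite, 's::finite, 'e, 'q, 'z) mesh_scheme \<Rightarrow> 'q \<Rightarrow> (real^'d) set" where
  "mo D m = mo_map D m ` ref_mo D m"

definition coord :: "('d::finite, 's::finite, 'e, 'q, 'z) mesh_scheme \<Rightarrow> real^'d \<Rightarrow> 3 \<Rightarrow> real" where
  "coord D x j = (if j \<in> range (ax D) then x $ inv (ax D) j else 0)"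

definition jac :: "('d::finite, 's::finite, 'e, 'q, 'z) mesh_scheme \<Rightarrow> 'e \<Rightarrow> real^'d \<Rightarrow> real" where
  "jac D e r = det (matrix (frechet_derivative (el_map D e) (at r within ref_el D e)))"

definition surf_jac :: "('d::finite, 's::finite, 'e, 'q, 'z) mesh_scheme \<Rightarrow> 'q \<Rightarrow> real^'s \<Rightarrow> real" where
  "surf_jac D m s =
     (let A = matrix (frechet_derivative (mo_map D m) (at s within ref_mo D m))
      in sqrt (det (transpose A ** A)))"

definition el_inv :: "('d::finite, 's::finite, 'e, 'q, 'z) mesh_scheme \<Rightarrow> 'e \<Rightarrow> real^'d \<Rightarrow> real^'d" where
  "el_inv D e = inv_into (ref_el D e) (el_map D e)"

text \<open>\<open>pd D e j q\<close> is the derivative of \<open>q\<close> with respect to the physical coordinate \<open>x\<^sub>j\<close>, as a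
  function on the reference element, by the chain rule.\<close>

definition pd :: "('d::finite, 's::finite, 'e, 'q, 'z) mesh_scheme \<Rightarrow> 'e \<Rightarrow> 3
    \<Rightarrow> (real^'d \<Rightarrow> real) \<Rightarrow> real^'d \<Rightarrow> real" where
  "pd D e j q r =
     (if j \<in> range (ax D)
      then \<Sum>k\<in>UNIV.
             frechet_derivative (el_inv D e) (at (el_map D e r) within el D e)
               (axis (inv (ax D) j) 1) $ k
             * frechet_derivative q (at r within ref_el D e) (axis k 1)
      else 0)"

text \<open>
  An element and a mortar element meet if the boundary of the former covers a part of the latter
  of positive (d-1)-dimensional measure; common corners or edges do not count.
\<close>

definition meets :: "('d::finite, 's::finite, 'e, 'q, 'z) mesh_scheme \<Rightarrow> 'q \<Rightarrow> 'e \<Rightarrow> bool" where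
  "meets D m e \<longleftrightarrow> \<not> negligible {s \<in> ref_mo D m. mo_map D m s \<in> frontier (el D e)}"

definition mortars_of :: "('d::finite, 's::finite, 'e, 'q, 'z) mesh_scheme \<Rightarrow> 'e \<Rightarrow> 'q set" where
  "mortars_of D e = {m \<in> mortars D. meets D m e}"

definition elems_of :: "('d::finite, 's::finite, 'e, 'q, 'z) mesh_scheme \<Rightarrow> 'q \<Rightarrow> 'e set" where
  "elems_of D m = {e \<in> elems D. meets D m e}"

text \<open>The mortar normal points away from the minus side: it is outward to the minus elements and
  inward to the plus elements.\<close>

definition elems_minus :: "('d::finite, 's::finite, 'e, 'q, 'z) mesh_scheme \<Rightarrow> 'q \<Rightarrow> 'e set" where
  "elems_minus D m = {e \<in> elems_of D m. AE s in lebesgue_on (ref_mo D m).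
     mo_map D m s \<in> frontier (el D e) \<longrightarrow>
       outward_normal (el D e) (mo_map D m s) (mo_normal D m s)}"

definition elems_plus :: "('d::finite, 's::finite, 'e, 'q, 'z) mesh_scheme \<Rightarrow> 'q \<Rightarrow> 'e set" where
  "elems_plus D m = {e \<in> elems_of D m. AE s in lebesgue_on (ref_mo D m).
     mo_map D m s \<in> frontier (el D e) \<longrightarrow>
       outward_normal (el D e) (mo_map D m s) (- mo_normal D m s)}"

definition boundary_mortar :: "('d::finite, 's::finite, 'e, 'q, 'z) mesh_scheme \<Rightarrow> 'q \<Rightarrow> bool" where
  "boundary_mortar D m \<longleftrightarrow> mo D m \<subseteq> frontier (region D)"

definition mesh_ok :: "('d::finite, 's::finite, 'e, 'q, 'z) mesh_scheme \<Rightarrow> bool" where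
  "mesh_ok D \<longleftrightarrow>
     inj (ax D) \<and> (CARD('d) = 2 \<longrightarrow> range (ax D) = {1, 2}) \<and>
     open (region D) \<and> finite (elems D) \<and> finite (mortars D) \<and>
     (\<forall>e\<in>elems D. ref_domain (ref_el D e) \<and> diffeo_on (ref_el D e) (el_map D e) \<and>
        (\<forall>r\<in>interior (ref_el D e). jac D e r > 0)) \<and>
     (\<Union>e\<in>elems D. el D e) = closure (region D) \<and>
     (\<Union>e\<in>elems D. interior (el D e)) \<subseteq> region D \<and>
     (\<forall>e\<in>elems D. \<forall>e'\<in>elems D. e \<noteq> e' \<longrightarrow> interior (el D e) \<inter> interior (el D e') = {}) \<and>
     (\<forall>m\<in>mortars D. ref_domain (ref_mo D m) \<and> diffeo_on (ref_mo D m) (mo_map D m) \<and>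
        (\<forall>s\<in>interior (ref_mo D m). surf_jac D m s > 0)) \<and>
     (\<Union>m\<in>mortars D. mo D m) = (\<Union>e\<in>elems D. frontier (el D e)) \<and>
     (\<forall>m\<in>mortars D. \<forall>m'\<in>mortars D. m \<noteq> m' \<longrightarrow>
        negligible {s \<in> ref_mo D m. mo_map D m s \<in> mo D m'}) \<and>
     (\<forall>m\<in>mortars D. continuous_on (ref_mo D m) (mo_normal D m) \<and>
        (\<forall>s\<in>interior (ref_mo D m). norm (mo_normal D m s) = 1 \<and>
           (\<forall>w. mo_normal D m s
                  \<bullet> frechet_derivative (mo_map D m) (at s within ref_mo D m) w = 0))) \<and>
     (\<forall>m\<in>mortars D. elems_of D m = elems_plus D m \<union> elems_minus D m \<and>
        elems_plus D m \<inter> elems_minus D m = {}) \<and>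
     (\<forall>m\<in>mortars D. boundary_mortar D m \<longrightarrow>
        (AE s in lebesgue_on (ref_mo D m).
           outward_normal (region D) (mo_map D m s) (mo_normal D m s)) \<and>
        elems_plus D m = {})"


section \<open>Material, approximation spaces and mortar operators\<close>

text \<open>The two variants of the mortar value of \<open>n\<^sub>j \<psi>\<^sub>i\<^sub>j\<close>: multiplication by the element normal
  before applying the mortar operator, or by the mortar normal afterwards.\<close>

datatype normal_choice = Element_Normal | Mortar_Normal

record ('d::finite, 's::finite, 'e, 'q) dg = "('d, 's, 'e, 'q) mesh" +
  density :: "real^'d \<Rightarrow> real"
  compliance :: "real^'d \<Rightarrow> 3 \<Rightarrow> 3 \<Rightarrow> 3 \<Rightarrow> 3 \<Rightarrow> real"
  el_space :: "'e \<Rightarrow> (real^'d \<Rightarrow> real) set"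
  mo_space :: "'q \<Rightarrow> (real^'s \<Rightarrow> real) set"
  mo_op :: "'q \<Rightarrow> 'e \<Rightarrow> (real^'d \<Rightarrow> real) \<Rightarrow> real^'s \<Rightarrow> real"
  el_normal :: "'e \<Rightarrow> real^'d \<Rightarrow> real^'d"
  nchoice :: normal_choice

text \<open>Functions on a reference domain are represented by their extension by zero.\<close>

definition fin_dim_space_on :: "'a set \<Rightarrow> ('a \<Rightarrow> real) set \<Rightarrow> bool" where
  "fin_dim_space_on A V \<longleftrightarrow>
     (\<exists>B. finite B \<and> V = {f. \<exists>c. f = (\<lambda>x. \<Sum>b\<in>B. c b * b x)}) \<and>
     (\<forall>f\<in>V. \<forall>x. x \<notin> A \<longrightarrow> f x = 0)"

definition L2_on :: "'a::euclidean_space set \<Rightarrow> ('a \<Rightarrow> real) \<Rightarrow> bool" where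
  "L2_on A f \<longleftrightarrow> f \<in> borel_measurable (lebesgue_on A) \<and> integrable (lebesgue_on A) (\<lambda>x. (f x)\<^sup>2)"

definition material_ok :: "('d::finite, 's::finite, 'e, 'q, 'z) dg_scheme \<Rightarrow> bool" where
  "material_ok D \<longleftrightarrow> (\<forall>x\<in>region D. density D x > 0 \<and>
     (\<forall>i j k l. compliance D x i j k l = compliance D x k l i j \<and>
                compliance D x i j k l = compliance D x j i k l \<and>
                compliance D x i j k l = compliance D x i j l k) \<and>
     (\<forall>a :: real^3^3. transpose a = a \<and> a \<noteq> 0 \<longrightarrow>
        (\<Sum>i\<in>UNIV. \<Sum>j\<in>UNIV. \<Sum>k\<in>UNIV. \<Sum>l\<in>UNIV.
            a $ i $ j * compliance D x i j k l * a $ k $ l) > 0))"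

definition spaces_ok :: "('d::finite, 's::finite, 'e, 'q, 'z) dg_scheme \<Rightarrow> bool" where
  "spaces_ok D \<longleftrightarrow>
     (\<forall>e\<in>elems D. fin_dim_space_on (ref_el D e) (el_space D e) \<and>
        (\<forall>f\<in>el_space D e. L2_on (ref_el D e) f \<and>
           (\<forall>r\<in>interior (ref_el D e). f differentiable at r)) \<and>
        (\<forall>f\<in>el_space D e. \<forall>g\<in>el_space D e.
           integrable (lebesgue_on (ref_el D e))
             (\<lambda>r. jac D e r * density D (el_map D e r) * f r * g r) \<and>
           (\<forall>i j k l. integrable (lebesgue_on (ref_el D e))
             (\<lambda>r. jac D e r * compliance D (el_map D e r) i j k l * f r * g r)) \<and>
           (\<forall>j. integrable (lebesgue_on (ref_el D e))
             (\<lambda>r. jac D e r * pd D e j f r * g r)))) \<and>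
     (\<forall>m\<in>mortars D. fin_dim_space_on (ref_mo D m) (mo_space D m) \<and>
        (\<forall>f\<in>mo_space D m. L2_on (ref_mo D m) f))"

definition linear_on :: "('a \<Rightarrow> real) set \<Rightarrow> ('b \<Rightarrow> real) set
    \<Rightarrow> (('a \<Rightarrow> real) \<Rightarrow> 'b \<Rightarrow> real) \<Rightarrow> bool" where
  "linear_on V U P \<longleftrightarrow> (\<forall>f\<in>V. P f \<in> U) \<and>
     (\<forall>f\<in>V. \<forall>g\<in>V. \<forall>a b. P (\<lambda>x. a * f x + b * g x) = (\<lambda>s. a * P f s + b * P g s))"

definition face_values :: "('d::finite, 's::finite, 'e, 'q, 'z) mesh_scheme \<Rightarrow> 'e
    \<Rightarrow> (real^'d \<Rightarrow> real) \<Rightarrow> real^'d \<Rightarrow> real" where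
  "face_values D e f r = (if r \<in> frontier (ref_el D e) then f r else 0)"

definition el_normal_comp :: "('d::finite, 's::finite, 'e, 'q, 'z) dg_scheme \<Rightarrow> 'e \<Rightarrow> 3
    \<Rightarrow> real^'d \<Rightarrow> real" where
  "el_normal_comp D e j r = coord D (el_normal D e (el_map D e r)) j"

text \<open>
  If the element normal is multiplied in first, the mortar operator acts on face values, so it
  must be defined on the larger space spanned by the approximation space and the face values of
  its functions, with and without a normal component as factor, and must only see face values.
\<close>

definition proj_domain :: "('d::finite, 's::finite, 'e, 'q, 'z) dg_scheme \<Rightarrow> 'e
    \<Rightarrow> (real^'d \<Rightarrow> real) set" where
  "proj_domain D e = (case nchoice D of
     Mortar_Normal \<Rightarrow> el_space D e
   | Element_Normal \<Rightarrow> {f. \<exists>g h. \<exists>q :: 3 \<Rightarrow> real^'d \<Rightarrow> real.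
       g \<in> el_space D e \<and> h \<in> el_space D e \<and> (\<forall>j. q j \<in> el_space D e) \<and>
       f = (\<lambda>r. g r + face_values D e
                         (\<lambda>r'. h r' + (\<Sum>j\<in>UNIV. el_normal_comp D e j r' * q j r')) r)})"

definition projections_ok :: "('d::finite, 's::finite, 'e, 'q, 'z) dg_scheme \<Rightarrow> bool" where
  "projections_ok D \<longleftrightarrow>
     (\<forall>m\<in>mortars D. \<forall>e\<in>elems_of D m.
        linear_on (proj_domain D e) (mo_space D m) (mo_op D m e) \<and>
        (nchoice D = Element_Normal \<longrightarrow>
           (\<forall>f\<in>el_space D e. mo_op D m e f = mo_op D m e (face_values D e f)))) \<and>
     (\<forall>e\<in>elems D. \<forall>x\<in>frontier (el D e). \<forall>\<nu>.
        outward_normal (el D e) x \<nu> \<longrightarrow> el_normal D e x = \<nu>)"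

definition dg_ok :: "('d::finite, 's::finite, 'e, 'q, 'z) dg_scheme \<Rightarrow> bool" where
  "dg_ok D \<longleftrightarrow> mesh_ok D \<and> material_ok D \<and> spaces_ok D \<and> projections_ok D"


section \<open>Mortar states and numerical flux\<close>

definition proj_vec :: "('d::finite, 's::finite, 'e, 'q, 'z) dg_scheme \<Rightarrow> 'q \<Rightarrow> 'e
    \<Rightarrow> (real^'d \<Rightarrow> real^3) \<Rightarrow> real^'s \<Rightarrow> real^3" where
  "proj_vec D m e \<phi> s = (\<chi> i. mo_op D m e (\<lambda>r. \<phi> r $ i) s)"

definition mo_normal_out :: "('d::finite, 's::finite, 'e, 'q, 'z) mesh_scheme \<Rightarrow> 'q \<Rightarrow> 'e
    \<Rightarrow> real^'s \<Rightarrow> real^'d" where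
  "mo_normal_out D m e s = (if e \<in> elems_minus D m then mo_normal D m s else - mo_normal D m s)"

definition traction :: "('d::finite, 's::finite, 'e, 'q, 'z) dg_scheme \<Rightarrow> 'q \<Rightarrow> 'e
    \<Rightarrow> (real^'d \<Rightarrow> real^3^3) \<Rightarrow> real^'s \<Rightarrow> real^3" where
  "traction D m e \<psi> s = (case nchoice D of
     Element_Normal \<Rightarrow>
       (\<chi> i. mo_op D m e (face_values D e
                (\<lambda>r. \<Sum>j\<in>UNIV. el_normal_comp D e j r * \<psi> r $ i $ j)) s)
   | Mortar_Normal \<Rightarrow>
       (\<chi> i. \<Sum>j\<in>UNIV. coord D (mo_normal_out D m e s) j * mo_op D m e (\<lambda>r. \<psi> r $ i $ j) s))"

definition v_minus :: "('d::finite, 's::finite, 'e, 'q, 'z) dg_scheme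
    \<Rightarrow> ('e \<Rightarrow> real^'d \<Rightarrow> real^3) \<Rightarrow> 'q \<Rightarrow> real^'s \<Rightarrow> real^3" where
  "v_minus D v m s = (\<Sum>e\<in>elems_minus D m. proj_vec D m e (v e) s)"

definition v_plus :: "('d::finite, 's::finite, 'e, 'q, 'z) dg_scheme
    \<Rightarrow> ('e \<Rightarrow> real^'d \<Rightarrow> real^3) \<Rightarrow> 'q \<Rightarrow> real^'s \<Rightarrow> real^3" where
  "v_plus D v m s = (\<Sum>e\<in>elems_plus D m. proj_vec D m e (v e) s)"

definition T_minus :: "('d::finite, 's::finite, 'e, 'q, 'z) dg_scheme
    \<Rightarrow> ('e \<Rightarrow> real^'d \<Rightarrow> real^3^3) \<Rightarrow> 'q \<Rightarrow> real^'s \<Rightarrow> real^3" where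
  "T_minus D \<sigma> m s = (\<Sum>e\<in>elems_minus D m. traction D m e (\<sigma> e) s)"

definition T_plus :: "('d::finite, 's::finite, 'e, 'q, 'z) dg_scheme
    \<Rightarrow> ('e \<Rightarrow> real^'d \<Rightarrow> real^3^3) \<Rightarrow> 'q \<Rightarrow> real^'s \<Rightarrow> real^3" where
  "T_plus D \<sigma> m s = - (\<Sum>e\<in>elems_plus D m. traction D m e (\<sigma> e) s)"

text \<open>Arguments: mortar element, point of the reference mortar element, and the states
  \<open>v\<close>-minus, \<open>v\<close>-plus, \<open>T\<close>-minus, \<open>T\<close>-plus (at the boundary \<open>v\<close>-minus, \<open>T\<close>-minus) there.\<close>

record ('s::finite, 'q) num_flux =
  T_int :: "'q \<Rightarrow> real^'s \<Rightarrow> real^3 \<Rightarrow> real^3 \<Rightarrow> real^3 \<Rightarrow> real^3 \<Rightarrow> real^3"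
  v_int :: "'q \<Rightarrow> real^'s \<Rightarrow> real^3 \<Rightarrow> real^3 \<Rightarrow> real^3 \<Rightarrow> real^3 \<Rightarrow> real^3"
  T_bdry :: "'q \<Rightarrow> real^'s \<Rightarrow> real^3 \<Rightarrow> real^3 \<Rightarrow> real^3"
  v_bdry :: "'q \<Rightarrow> real^'s \<Rightarrow> real^3 \<Rightarrow> real^3 \<Rightarrow> real^3"

definition T_star :: "('d::finite, 's::finite, 'e, 'q, 'z) dg_scheme \<Rightarrow> ('s, 'q) num_flux
    \<Rightarrow> ('e \<Rightarrow> real^'d \<Rightarrow> real^3) \<Rightarrow> ('e \<Rightarrow> real^'d \<Rightarrow> real^3^3) \<Rightarrow> 'q \<Rightarrow> real^'s \<Rightarrow> real^3" where
  "T_star D F v \<sigma> m s =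
     (if boundary_mortar D m then T_bdry F m s (v_minus D v m s) (T_minus D \<sigma> m s)
      else T_int F m s (v_minus D v m s) (v_plus D v m s) (T_minus D \<sigma> m s) (T_plus D \<sigma> m s))"

definition v_star :: "('d::finite, 's::finite, 'e, 'q, 'z) dg_scheme \<Rightarrow> ('s, 'q) num_flux
    \<Rightarrow> ('e \<Rightarrow> real^'d \<Rightarrow> real^3) \<Rightarrow> ('e \<Rightarrow> real^'d \<Rightarrow> real^3^3) \<Rightarrow> 'q \<Rightarrow> real^'s \<Rightarrow> real^3" where
  "v_star D F v \<sigma> m s =
     (if boundary_mortar D m then v_bdry F m s (v_minus D v m s) (T_minus D \<sigma> m s)
      else v_int F m s (v_minus D v m s) (v_plus D v m s) (T_minus D \<sigma> m s) (T_plus D \<sigma> m s))"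

definition T_star_el :: "('d::finite, 's::finite, 'e, 'q, 'z) dg_scheme \<Rightarrow> ('s, 'q) num_flux
    \<Rightarrow> ('e \<Rightarrow> real^'d \<Rightarrow> real^3) \<Rightarrow> ('e \<Rightarrow> real^'d \<Rightarrow> real^3^3) \<Rightarrow> 'q \<Rightarrow> 'e
    \<Rightarrow> real^'s \<Rightarrow> real^3" where
  "T_star_el D F v \<sigma> m e s =
     (if e \<in> elems_minus D m then T_star D F v \<sigma> m s else - T_star D F v \<sigma> m s)"

definition v_side :: "('d::finite, 's::finite, 'e, 'q, 'z) dg_scheme
    \<Rightarrow> ('e \<Rightarrow> real^'d \<Rightarrow> real^3) \<Rightarrow> 'q \<Rightarrow> 'e \<Rightarrow> real^'s \<Rightarrow> real^3" where
  "v_side D v m e s = (if e \<in> elems_minus D m then v_minus D v m s else v_plus D v m s)"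


section \<open>The method and its energy\<close>

definition vec_fields :: "('d::finite, 's::finite, 'e, 'q, 'z) dg_scheme \<Rightarrow> 'e
    \<Rightarrow> (real^'d \<Rightarrow> real^3) set" where
  "vec_fields D e = {\<phi>. \<forall>i. (\<lambda>r. \<phi> r $ i) \<in> el_space D e}"

definition sym_fields :: "('d::finite, 's::finite, 'e, 'q, 'z) dg_scheme \<Rightarrow> 'e
    \<Rightarrow> (real^'d \<Rightarrow> real^3^3) set" where
  "sym_fields D e = {\<psi>. (\<forall>i j. (\<lambda>r. \<psi> r $ i $ j) \<in> el_space D e) \<and>
                         (\<forall>r i j. \<psi> r $ i $ j = \<psi> r $ j $ i)}"

definition time_deriv :: "(real \<Rightarrow> 'a \<Rightarrow> 'b::real_normed_vector) \<Rightarrow> real \<Rightarrow> 'a \<Rightarrow> 'b" where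
  "time_deriv u t r = vector_derivative (\<lambda>\<tau>. u \<tau> r) (at t within {0..})"

definition velocity_eq :: "('d::finite, 's::finite, 'e, 'q, 'z) dg_scheme \<Rightarrow> ('s, 'q) num_flux
    \<Rightarrow> ('e \<Rightarrow> real \<Rightarrow> real^'d \<Rightarrow> real^3) \<Rightarrow> ('e \<Rightarrow> real \<Rightarrow> real^'d \<Rightarrow> real^3^3)
    \<Rightarrow> 'e \<Rightarrow> real \<Rightarrow> (real^'d \<Rightarrow> real^3) \<Rightarrow> bool" where
  "velocity_eq D F v \<sigma> e t \<phi> \<longleftrightarrow>
     (\<integral>r. jac D e r * density D (el_map D e r) * (\<phi> r \<bullet> time_deriv (v e) t r)
        \<partial>lebesgue_on (ref_el D e))
     = - (\<integral>r. jac D e r *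
             (\<Sum>i\<in>UNIV. \<Sum>j\<in>UNIV. pd D e j (\<lambda>r. \<phi> r $ i) r * \<sigma> e t r $ i $ j)
           \<partial>lebesgue_on (ref_el D e))
       + (\<Sum>m\<in>mortars_of D e.
            \<integral>s. surf_jac D m s *
                 (proj_vec D m e \<phi> s \<bullet> T_star_el D F (\<lambda>e. v e t) (\<lambda>e. \<sigma> e t) m e s)
              \<partial>lebesgue_on (ref_mo D m))"

definition stress_eq :: "('d::finite, 's::finite, 'e, 'q, 'z) dg_scheme \<Rightarrow> ('s, 'q) num_flux
    \<Rightarrow> ('e \<Rightarrow> real \<Rightarrow> real^'d \<Rightarrow> real^3) \<Rightarrow> ('e \<Rightarrow> real \<Rightarrow> real^'d \<Rightarrow> real^3^3)
    \<Rightarrow> 'e \<Rightarrow> real \<Rightarrow> (real^'d \<Rightarrow> real^3^3) \<Rightarrow> bool" where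
  "stress_eq D F v \<sigma> e t \<psi> \<longleftrightarrow>
     (\<integral>r. jac D e r * (\<Sum>i\<in>UNIV. \<Sum>j\<in>UNIV. \<Sum>k\<in>UNIV. \<Sum>l\<in>UNIV.
            \<psi> r $ i $ j * compliance D (el_map D e r) i j k l * time_deriv (\<sigma> e) t r $ k $ l)
        \<partial>lebesgue_on (ref_el D e))
     = (\<integral>r. jac D e r / 2 * (\<Sum>i\<in>UNIV. \<Sum>j\<in>UNIV. \<psi> r $ i $ j *
              (pd D e j (\<lambda>r. v e t r $ i) r + pd D e i (\<lambda>r. v e t r $ j) r))
          \<partial>lebesgue_on (ref_el D e))
       + (\<Sum>m\<in>mortars_of D e.
            \<integral>s. surf_jac D m s *
                 (traction D m e \<psi> s \<bullet>
                    (v_star D F (\<lambda>e. v e t) (\<lambda>e. \<sigma> e t) m s - v_side D (\<lambda>e. v e t) m e s))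
              \<partial>lebesgue_on (ref_mo D m))"

text \<open>Since the numerical flux is an arbitrary pointwise function of the states, existence of the
  mortar integrals in the two equations is part of the notion of solution.\<close>

definition flux_integrals_exist :: "('d::finite, 's::finite, 'e, 'q, 'z) dg_scheme
    \<Rightarrow> ('s, 'q) num_flux
    \<Rightarrow> ('e \<Rightarrow> real \<Rightarrow> real^'d \<Rightarrow> real^3) \<Rightarrow> ('e \<Rightarrow> real \<Rightarrow> real^'d \<Rightarrow> real^3^3)
    \<Rightarrow> 'e \<Rightarrow> real \<Rightarrow> bool" where
  "flux_integrals_exist D F v \<sigma> e t \<longleftrightarrow> (\<forall>m\<in>mortars_of D e.
     (\<forall>\<phi>\<in>vec_fields D e. integrable (lebesgue_on (ref_mo D m))
        (\<lambda>s. surf_jac D m s *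
             (proj_vec D m e \<phi> s \<bullet> T_star_el D F (\<lambda>e. v e t) (\<lambda>e. \<sigma> e t) m e s))) \<and>
     (\<forall>\<psi>\<in>sym_fields D e. integrable (lebesgue_on (ref_mo D m))
        (\<lambda>s. surf_jac D m s *
             (traction D m e \<psi> s \<bullet>
                (v_star D F (\<lambda>e. v e t) (\<lambda>e. \<sigma> e t) m s - v_side D (\<lambda>e. v e t) m e s)))))"

definition dg_solution :: "('d::finite, 's::finite, 'e, 'q, 'z) dg_scheme \<Rightarrow> ('s, 'q) num_flux
    \<Rightarrow> ('e \<Rightarrow> real \<Rightarrow> real^'d \<Rightarrow> real^3) \<Rightarrow> ('e \<Rightarrow> real \<Rightarrow> real^'d \<Rightarrow> real^3^3) \<Rightarrow> bool" where
  "dg_solution D F v \<sigma> \<longleftrightarrow> (\<forall>e\<in>elems D. \<forall>t\<ge>0.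
     v e t \<in> vec_fields D e \<and> \<sigma> e t \<in> sym_fields D e \<and>
     (\<forall>r. (\<lambda>\<tau>. v e \<tau> r) differentiable (at t within {0..}) \<and>
          (\<lambda>\<tau>. \<sigma> e \<tau> r) differentiable (at t within {0..})) \<and>
     flux_integrals_exist D F v \<sigma> e t \<and>
     (\<forall>\<phi>\<in>vec_fields D e. velocity_eq D F v \<sigma> e t \<phi>) \<and>
     (\<forall>\<psi>\<in>sym_fields D e. stress_eq D F v \<sigma> e t \<psi>))"

definition el_energy :: "('d::finite, 's::finite, 'e, 'q, 'z) dg_scheme \<Rightarrow> 'e
    \<Rightarrow> (real^'d \<Rightarrow> real^3) \<Rightarrow> (real^'d \<Rightarrow> real^3^3) \<Rightarrow> real" where
  "el_energy D e v \<sigma> =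
     (\<integral>r. jac D e r *
        (density D (el_map D e r) / 2 * (v r \<bullet> v r)
         + 1 / 2 * (\<Sum>i\<in>UNIV. \<Sum>j\<in>UNIV. \<Sum>k\<in>UNIV. \<Sum>l\<in>UNIV.
             \<sigma> r $ i $ j * compliance D (el_map D e r) i j k l * \<sigma> r $ k $ l))
      \<partial>lebesgue_on (ref_el D e))"

definition energy :: "('d::finite, 's::finite, 'e, 'q, 'z) dg_scheme
    \<Rightarrow> ('e \<Rightarrow> real^'d \<Rightarrow> real^3) \<Rightarrow> ('e \<Rightarrow> real^'d \<Rightarrow> real^3^3) \<Rightarrow> real" where
  "energy D v \<sigma> = (\<Sum>e\<in>elems D. el_energy D e (v e) (\<sigma> e))"

end

theory Submission
  imports Defs
begin

text \<open>
  The energy never increases because the flux condition is exactly the statement that each mortar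
  element dissipates energy.  Testing the velocity equation with \<open>v\<close> itself and the stress
  equation with \<open>\<sigma>\<close> itself, the two volume integrals cancel: by symmetry of \<open>\<sigma>\<close>, the power
  \<open>\<sigma>\<^sub>i\<^sub>j \<partial>\<^sub>j v\<^sub>i\<close> appears with opposite signs.  What remains of \<open>d\<E>\<^sup>e/dt\<close> is a sum of integrals over the
  mortar elements of \<open>e\<close> (\<open>el_power_balance\<close>).  Regrouping the total by mortar elements, the
  contributions of the two sides of a mortar element add up, pointwise, to the expression
  assumed non-positive (\<open>mortar_power_sum\<close>).  Hence \<open>d\<E>/dt \<le> 0\<close>.

  The analytic part is to justify that \<open>d\<E>\<^sup>e/dt\<close> equals the left-hand sides of the two tested
  equations.  A solution is only known to be differentiable in time at each point of the
  reference element, but it takes values in a finite-dimensional space of functions.  Such a space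
  has finitely many evaluation points that determine its members linearly (\<open>nodal_basis\<close>), so
  the energy is a quadratic polynomial in finitely many differentiable functions of time, and
  the pointwise time derivative lies in the same space (\<open>has_derivative_weighted_integral\<close>).
  Merging the two terms of the derivative of the elastic energy takes the symmetry
  \<open>S\<^sub>i\<^sub>j\<^sub>k\<^sub>l = S\<^sub>k\<^sub>l\<^sub>i\<^sub>j\<close>, which is given inside the open region; almost every point of a reference
  element is mapped there (\<open>AE_el_map_in_region\<close>).
\<close>


section \<open>Finite-dimensional function spaces\<close>

text \<open>
  Lagrange interpolation in a finitely spanned function space; the nodes are found by induction on
  the generators.  When a generator \<open>b\<close> is added, its interpolation error \<open>b'\<close>
  vanishes at all old nodes.  Either \<open>b' = 0\<close> and the old basis still serves, or a point
  where \<open>b'\<close> is nonzero is a new node, with basis function \<open>\<zeta>\<close> a multiple of \<open>b'\<close>, and the old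
  basis functions are corrected by multiples of \<open>\<zeta>\<close> to vanish there.
\<close>

lemma nodal_basis_span:
  fixes B :: "('a \<Rightarrow> real) set"
  assumes "finite B"
  shows "\<exists>X \<beta>. finite X \<and>
           (\<forall>p\<in>X. \<exists>c. \<beta> p = (\<lambda>x. \<Sum>b\<in>B. c b * b x)) \<and>
           (\<forall>p\<in>X. \<forall>q\<in>X. \<beta> p q = (if p = q then 1 else 0)) \<and>
           (\<forall>c x. (\<Sum>b\<in>B. c b * b x) = (\<Sum>p\<in>X. (\<Sum>b\<in>B. c b * b p) * \<beta> p x))"
  using assms
proof (induction B rule: finite_induct)
  case empty
  show ?case by (rule exI[of _ "{}"]) auto
next
  case (insert b B)
  let ?span = "\<lambda>c x. \<Sum>b\<in>B. c b * b x"
  from insert.IH obtain X :: "'a set" and \<beta> where X: "finite X"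
    and \<beta>: "\<forall>p\<in>X. \<exists>c. \<beta> p = ?span c"
    and \<delta>': "\<forall>p\<in>X. \<forall>q\<in>X. \<beta> p q = (if p = q then 1 else 0)"
    and rep': "\<forall>c x. ?span c x = (\<Sum>p\<in>X. ?span c p * \<beta> p x)"
    by (elim exE conjE)
  note \<delta> = \<delta>'[rule_format] and rep = rep'[rule_format]
  \<comment> \<open>Each old basis function as an explicit combination of the old generators.\<close>
  obtain C where C: "\<And>p. p \<in> X \<Longrightarrow> \<beta> p = ?span (C p)"
    using bchoice[OF \<beta>] by (elim exE) blast
  define b' where "b' x = b x - (\<Sum>p\<in>X. b p * \<beta> p x)" for x
  have b'_X: "b' q = 0" if "q \<in> X" for q
  proof -
    have "(\<Sum>p\<in>X. b p * \<beta> p q) = (\<Sum>p\<in>X. if p = q then b p else 0)"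
      using \<delta> that by (intro sum.cong) auto
    then show ?thesis using that X by (simp add: b'_def)
  qed
  have ins: "(\<Sum>a\<in>insert b B. c a * a x) = c b * b x + ?span c x" for c x
    using insert.hyps by simp
  have ins': "\<exists>c. (\<lambda>x. u * b x + ?span d x) = (\<lambda>x. \<Sum>a\<in>insert b B. c a * a x)" for u d
  proof (intro exI ext)
    fix x
    have "?span (d(b := u)) x = ?span d x"
      using insert.hyps by (intro sum.cong) auto
    then show "u * b x + ?span d x = (\<Sum>a\<in>insert b B. (d(b := u)) a * a x)"
      unfolding ins by simp
  qed
  show ?case
  proof (cases "\<forall>x. b' x = 0")
    case True
    have b: "b x = (\<Sum>p\<in>X. b p * \<beta> p x)" for x
      using True[rule_format, of x] by (simp add: b'_def)
    show ?thesis
    proof (rule exI[of _ X], rule exI[of _ \<beta>], intro conjI allI ballI)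
      show "finite X" by fact
    next
      fix p assume "p \<in> X"
      then show "\<exists>c. \<beta> p = (\<lambda>x. \<Sum>a\<in>insert b B. c a * a x)"
        using ins'[of 0 "C p"] C by auto
    next
      fix p q assume "p \<in> X" "q \<in> X"
      then show "\<beta> p q = (if p = q then 1 else 0)" by (rule \<delta>)
    next
      fix c x
      have "(\<Sum>p\<in>X. (c b * b p + ?span c p) * \<beta> p x)
              = c b * (\<Sum>p\<in>X. b p * \<beta> p x) + (\<Sum>p\<in>X. ?span c p * \<beta> p x)"
        by (simp add: algebra_simps sum.distrib sum_distrib_left)
      then show "(\<Sum>a\<in>insert b B. c a * a x)
              = (\<Sum>p\<in>X. (\<Sum>a\<in>insert b B. c a * a p) * \<beta> p x)"
        unfolding ins using b[of x] rep[of c x] by simp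
    qed
  next
    case False
    then obtain z where z: "b' z \<noteq> 0" by blast
    have zX: "z \<notin> X" using b'_X z by blast
    define \<zeta> where "\<zeta> x = b' x / b' z" for x
    define \<gamma> where "\<gamma> p = (if p = z then \<zeta> else (\<lambda>x. \<beta> p x - \<beta> p z * \<zeta> x))" for p
    have \<gamma>z: "\<gamma> z = \<zeta>" and \<gamma>X: "\<And>p. p \<in> X \<Longrightarrow> \<gamma> p = (\<lambda>x. \<beta> p x - \<beta> p z * \<zeta> x)"
      using zX by (auto simp: \<gamma>_def)
    have \<zeta>_z: "\<zeta> z = 1" and \<zeta>_X: "\<And>q. q \<in> X \<Longrightarrow> \<zeta> q = 0"
      using z b'_X by (auto simp: \<zeta>_def)
    have swap: "(\<Sum>p\<in>X. u p * \<beta> p x) = ?span (\<lambda>a. \<Sum>p\<in>X. u p * C p a) x" for u x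
    proof -
      have "(\<Sum>p\<in>X. u p * \<beta> p x) = (\<Sum>p\<in>X. \<Sum>a\<in>B. u p * C p a * a x)"
        using C by (intro sum.cong) (auto simp: sum_distrib_left mult.assoc)
      also have "\<dots> = ?span (\<lambda>a. \<Sum>p\<in>X. u p * C p a) x"
        by (subst sum.swap) (simp add: sum_distrib_right)
      finally show ?thesis .
    qed
    obtain E where E: "\<And>x. \<zeta> x = (1 / b' z) * b x + ?span E x"
    proof
      fix x
      have "?span (\<lambda>a. \<Sum>p\<in>X. (- b p / b' z) * C p a) x = (\<Sum>p\<in>X. (- b p / b' z) * \<beta> p x)"
        using swap[of "\<lambda>p. - b p / b' z" x] by simp
      also have "\<dots> = - (\<Sum>p\<in>X. b p * \<beta> p x) / b' z"
        by (simp add: sum_divide_distrib sum_negf)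
      finally show "\<zeta> x = (1 / b' z) * b x + ?span (\<lambda>a. \<Sum>p\<in>X. (- b p / b' z) * C p a) x"
        by (simp add: \<zeta>_def b'_def diff_divide_distrib)
    qed
    show ?thesis
    proof (rule exI[of _ "insert z X"], rule exI[of _ \<gamma>], intro conjI allI ballI)
      show "finite (insert z X)" using X by simp
    next
      fix p assume p: "p \<in> insert z X"
      show "\<exists>c. \<gamma> p = (\<lambda>x. \<Sum>a\<in>insert b B. c a * a x)"
      proof (cases "p = z")
        case True
        have "\<gamma> p = (\<lambda>x. (1 / b' z) * b x + ?span E x)"
          using True \<gamma>z E by auto
        then show ?thesis using ins'[of "1 / b' z" E] by simp
      next
        case False
        then have pX: "p \<in> X" using p by simp
        have "\<gamma> p = (\<lambda>x. (- \<beta> p z / b' z) * b x + ?span (\<lambda>a. C p a - \<beta> p z * E a) x)"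
        proof
          fix x
          have "?span (\<lambda>a. C p a - \<beta> p z * E a) x = \<beta> p x - \<beta> p z * ?span E x"
            using fun_cong[OF C[OF pX], of x]
            by (simp add: left_diff_distrib sum_subtractf sum_distrib_left mult.assoc)
          then show "\<gamma> p x = (- \<beta> p z / b' z) * b x + ?span (\<lambda>a. C p a - \<beta> p z * E a) x"
            using pX E[of x] by (simp add: \<gamma>X algebra_simps)
        qed
        then show ?thesis using ins'[of "- \<beta> p z / b' z" "\<lambda>a. C p a - \<beta> p z * E a"] by simp
      qed
    next
      fix p q assume "p \<in> insert z X" "q \<in> insert z X"
      then show "\<gamma> p q = (if p = q then 1 else 0)"
        using \<gamma>z \<gamma>X \<zeta>_z \<zeta>_X \<delta> zX by auto
    next
      fix c x
      define f where "f y = c b * b y + ?span c y" for y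
      \<comment> \<open>\<open>g\<close> interpolates \<open>f\<close> at the old nodes, and \<open>d\<close> is the value of the error at the new one.\<close>
      define d where "d = c b * b' z"
      define g where "g y = (\<Sum>p\<in>X. f p * \<beta> p y)" for y
      have f: "f y = g y + d * \<zeta> y" for y
      proof -
        have "g y = c b * (\<Sum>p\<in>X. b p * \<beta> p y) + (\<Sum>p\<in>X. ?span c p * \<beta> p y)"
          by (simp add: g_def f_def algebra_simps sum.distrib sum_distrib_left)
        also have "\<dots> = c b * (b y - b' y) + ?span c y"
          using rep[of c y] by (simp add: b'_def)
        finally show ?thesis using z by (simp add: f_def d_def \<zeta>_def algebra_simps)
      qed
      have "(\<Sum>p\<in>insert z X. f p * \<gamma> p x) = f z * \<zeta> x + (\<Sum>p\<in>X. f p * \<gamma> p x)"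
        using X zX \<gamma>z by simp
      also have "(\<Sum>p\<in>X. f p * \<gamma> p x) = (\<Sum>p\<in>X. f p * \<beta> p x - f p * \<beta> p z * \<zeta> x)"
        by (intro sum.cong) (auto simp: \<gamma>X algebra_simps)
      also have "\<dots> = g x - g z * \<zeta> x"
        by (simp add: g_def sum_subtractf sum_distrib_right)
      also have "f z * \<zeta> x + (g x - g z * \<zeta> x) = f x"
        using f[of z] f[of x] \<zeta>_z by (simp add: algebra_simps)
      finally show "(\<Sum>a\<in>insert b B. c a * a x)
              = (\<Sum>p\<in>insert z X. (\<Sum>a\<in>insert b B. c a * a p) * \<gamma> p x)"
        unfolding ins f_def by simp
    qed
  qed
qed

lemma nodal_basis:
  assumes "fin_dim_space_on A V"
  obtains X \<beta> where "finite X" "\<And>p. p \<in> X \<Longrightarrow> \<beta> p \<in> V"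
    "\<And>f x. f \<in> V \<Longrightarrow> f x = (\<Sum>p\<in>X. f p * \<beta> p x)"
proof -
  obtain B where B: "finite B" "V = {f. \<exists>c. f = (\<lambda>x. \<Sum>b\<in>B. c b * b x)}"
    using assms unfolding fin_dim_space_on_def by blast
  from nodal_basis_span[OF B(1)] obtain X \<beta> where X: "finite X"
    and \<beta>: "\<forall>p\<in>X. \<exists>c. \<beta> p = (\<lambda>x. \<Sum>b\<in>B. c b * b x)"
    and rep: "\<forall>c x. (\<Sum>b\<in>B. c b * b x) = (\<Sum>p\<in>X. (\<Sum>b\<in>B. c b * b p) * \<beta> p x)"
    by blast
  show thesis
  proof (rule that[OF X])
    show "\<beta> p \<in> V" if "p \<in> X" for p
      using \<beta> B(2) that by blast
    show "f x = (\<Sum>p\<in>X. f p * \<beta> p x)" if "f \<in> V" for f x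
    proof -
      from that B(2) obtain c where "f = (\<lambda>x. \<Sum>b\<in>B. c b * b x)"
        by blast
      then show ?thesis using rep[rule_format, of c x] by simp
    qed
  qed
qed

text \<open>
  Differentiating the interpolation formula term by term shows that the pointwise derivative obeys
  the same formula, since derivatives within the half line are unique.
\<close>

lemma pointwise_derivative_nodal:
  fixes f :: "real \<Rightarrow> 'a \<Rightarrow> real"
  assumes rep: "\<And>\<tau> x. \<tau> \<ge> 0 \<Longrightarrow> f \<tau> x = (\<Sum>p\<in>X. f \<tau> p * \<beta> p x)"
    and f': "\<And>x. ((\<lambda>\<tau>. f \<tau> x) has_real_derivative f' x) (at t within {0..})"
    and t: "t \<ge> 0"
  shows "f' x = (\<Sum>p\<in>X. f' p * \<beta> p x)"
proof -
  have "((\<lambda>\<tau>. \<Sum>p\<in>X. f \<tau> p * \<beta> p x) has_real_derivative (\<Sum>p\<in>X. f' p * \<beta> p x))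
          (at t within {0..})"
    by (auto intro!: derivative_eq_intros f')
  then have "((\<lambda>\<tau>. f \<tau> x) has_real_derivative (\<Sum>p\<in>X. f' p * \<beta> p x)) (at t within {0..})"
    by (rule has_field_derivative_transform_within[where d = 1]) (use t rep in auto)
  moreover have "at t within {0..} \<noteq> bot"
  proof -
    have "at t within {t<..} \<noteq> bot" by simp
    moreover have "at t within {t<..} \<le> at t within {0..}"
      using t by (intro at_le) auto
    ultimately show ?thesis by (metis bot.extremum_uniqueI)
  qed
  ultimately show ?thesis
    using has_field_derivative_unique[OF f'] by blast
qed

text \<open>
  Differentiation under the integral without domination: in nodal coordinates the integral is the
  bilinear form \<open>\<Sum>\<^sub>p\<^sub>q f\<^sub>\<tau>(p) g\<^sub>\<tau>(q) K\<^sub>p\<^sub>q\<close> with a constant matrix, so the ordinary product rule suffices.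
  The integrals in the derivative exist because the derivatives lie in the space again.
\<close>

lemma has_derivative_weighted_integral:
  fixes f g :: "real \<Rightarrow> 'a \<Rightarrow> real"
  assumes V: "fin_dim_space_on A V"
    and int: "\<And>f g. f \<in> V \<Longrightarrow> g \<in> V \<Longrightarrow> integrable M (\<lambda>x. w x * f x * g x)"
    and fV: "\<And>\<tau>. \<tau> \<ge> 0 \<Longrightarrow> f \<tau> \<in> V" and gV: "\<And>\<tau>. \<tau> \<ge> 0 \<Longrightarrow> g \<tau> \<in> V"
    and f': "\<And>x. ((\<lambda>\<tau>. f \<tau> x) has_real_derivative f' x) (at t within {0..})"
    and g': "\<And>x. ((\<lambda>\<tau>. g \<tau> x) has_real_derivative g' x) (at t within {0..})"
    and t: "t \<ge> 0"
  shows "((\<lambda>\<tau>. \<integral>x. w x * f \<tau> x * g \<tau> x \<partial>M) has_real_derivative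
            (\<integral>x. w x * f' x * g t x \<partial>M) + (\<integral>x. w x * f t x * g' x \<partial>M)) (at t within {0..})"
    and "integrable M (\<lambda>x. w x * f' x * g t x)"
    and "integrable M (\<lambda>x. w x * f t x * g' x)"
proof -
  obtain X \<beta> where X: "finite X" and \<beta>: "\<And>p. p \<in> X \<Longrightarrow> \<beta> p \<in> V"
    and rep: "\<And>f x. f \<in> V \<Longrightarrow> f x = (\<Sum>p\<in>X. f p * \<beta> p x)"
    using nodal_basis[OF V] by blast
  define K where "K p q = (\<integral>x. w x * \<beta> p x * \<beta> q x \<partial>M)" for p q
  have expand: "integrable M (\<lambda>x. w x * a x * b x)"
    "(\<integral>x. w x * a x * b x \<partial>M) = (\<Sum>p\<in>X. \<Sum>q\<in>X. a p * b q * K p q)"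
    if a: "\<And>x. a x = (\<Sum>p\<in>X. a p * \<beta> p x)" and b: "\<And>x. b x = (\<Sum>p\<in>X. b p * \<beta> p x)" for a b
  proof -
    have eq: "w x * a x * b x = (\<Sum>p\<in>X. \<Sum>q\<in>X. a p * b q * (w x * \<beta> p x * \<beta> q x))" for x
      by (subst a, subst b) (simp add: sum_distrib_left sum_distrib_right mult_ac)
    show "integrable M (\<lambda>x. w x * a x * b x)"
      unfolding eq by (intro Bochner_Integration.integrable_sum integrable_mult_right int \<beta>)
    show "(\<integral>x. w x * a x * b x \<partial>M) = (\<Sum>p\<in>X. \<Sum>q\<in>X. a p * b q * K p q)"
      unfolding eq K_def using int \<beta> by (simp add: Bochner_Integration.integral_sum)
  qed
  have ft: "\<And>\<tau> x. \<tau> \<ge> 0 \<Longrightarrow> f \<tau> x = (\<Sum>p\<in>X. f \<tau> p * \<beta> p x)"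
    and gt: "\<And>\<tau> x. \<tau> \<ge> 0 \<Longrightarrow> g \<tau> x = (\<Sum>p\<in>X. g \<tau> p * \<beta> p x)"
    using rep fV gV by blast+
  have f'X: "\<And>x. f' x = (\<Sum>p\<in>X. f' p * \<beta> p x)" and g'X: "\<And>x. g' x = (\<Sum>p\<in>X. g' p * \<beta> p x)"
    using pointwise_derivative_nodal[OF ft f' t] pointwise_derivative_nodal[OF gt g' t] by blast+
  show "integrable M (\<lambda>x. w x * f' x * g t x)" "integrable M (\<lambda>x. w x * f t x * g' x)"
    using expand(1)[OF f'X gt[OF t]] expand(1)[OF ft[OF t] g'X] .
  have "((\<lambda>\<tau>. \<Sum>p\<in>X. \<Sum>q\<in>X. f \<tau> p * g \<tau> q * K p q) has_real_derivative
          (\<Sum>p\<in>X. \<Sum>q\<in>X. (f t p * g' q + f' p * g t q) * K p q)) (at t within {0..})"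
    by (intro DERIV_sum DERIV_cmult_right DERIV_mult' f' g')
  also have "(\<Sum>p\<in>X. \<Sum>q\<in>X. (f t p * g' q + f' p * g t q) * K p q)
      = (\<integral>x. w x * f' x * g t x \<partial>M) + (\<integral>x. w x * f t x * g' x \<partial>M)"
    unfolding expand(2)[OF f'X gt[OF t]] expand(2)[OF ft[OF t] g'X]
    by (simp add: distrib_right sum.distrib)
  finally show "((\<lambda>\<tau>. \<integral>x. w x * f \<tau> x * g \<tau> x \<partial>M) has_real_derivative
            (\<integral>x. w x * f' x * g t x \<partial>M) + (\<integral>x. w x * f t x * g' x \<partial>M)) (at t within {0..})"
    by (rule has_field_derivative_transform_within[where d = 1])
       (use t expand(2)[OF ft gt] in auto)
qed

section \<open>Symmetry of the compliance on the reference elements\<close>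

text \<open>
  An element map is only known to send the reference element into the closure of the region.  By
  invariance of domain it sends interior points to interior points of the element, which do lie in
  the region, and the frontier of the reference element is negligible.
\<close>

lemma AE_el_map_in_region:
  fixes D :: "('d::finite, 's::finite, 'e, 'q, 'z) mesh_scheme"
  assumes ok: "mesh_ok D" and e: "e \<in> elems D"
  shows "AE r in lebesgue_on (ref_el D e). el_map D e r \<in> region D"
proof -
  let ?A = "ref_el D e" and ?f = "el_map D e"
  have "ref_domain ?A" "diffeo_on ?A ?f"
    using ok e by (simp_all add: mesh_ok_def)
  then have A: "compact ?A" "negligible (frontier ?A)"
    and f: "inj_on ?f ?A" "C1_map_on ?A ?f"
    unfolding ref_domain_def diffeo_on_def by blast+
  have cont: "continuous_on ?A ?f"
  proof -
    from f(2) obtain W g g' where W: "?A \<subseteq> W" "\<forall>x\<in>?A. g x = ?f x"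
      "\<forall>x\<in>W. (g has_derivative blinfun_apply (g' x)) (at x)"
      unfolding C1_map_on_def by blast
    have "continuous_on ?A g"
      using W(1,3) by (meson continuous_at_imp_continuous_on has_derivative_continuous subsetD)
    then show ?thesis using W(2) by (simp cong: continuous_on_cong)
  qed
  have "open (?f ` interior ?A)"
    using cont f(1) interior_subset
    by (intro invariance_of_domain) (auto intro: continuous_on_subset inj_on_subset)
  then have "?f ` interior ?A \<subseteq> interior (el D e)"
    unfolding el_def using interior_subset by (intro interior_maximal image_mono)
  also have "\<dots> \<subseteq> region D"
    using ok e by (simp add: mesh_ok_def UN_subset_iff)
  finally have img: "?f ` interior ?A \<subseteq> region D" .
  have frontier_eq: "frontier ?A = ?A - interior ?A"
    using A(1) by (simp add: frontier_def compact_imp_closed closure_closed)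
  have "AE r in lebesgue. r \<notin> frontier ?A"
    using A(2) by (simp add: negligible_iff_null_sets AE_not_in)
  then have "AE r in lebesgue. r \<in> ?A \<longrightarrow> ?f r \<in> region D"
    by (rule AE_mp) (use img frontier_eq in auto)
  then show ?thesis
    using A(1) by (subst AE_restrict_space_iff) (auto simp: lmeasurable_compact fmeasurableD)
qed

section \<open>Energy balance\<close>

lemma has_time_derivative_components:
  fixes v :: "real \<Rightarrow> 'a \<Rightarrow> real^'n" and \<sigma> :: "real \<Rightarrow> 'a \<Rightarrow> real^'n^'m"
  shows "(\<lambda>\<tau>. v \<tau> r) differentiable (at t within {0..}) \<Longrightarrow>
      ((\<lambda>\<tau>. v \<tau> r $ i) has_real_derivative time_deriv v t r $ i) (at t within {0..})"
    and "(\<lambda>\<tau>. \<sigma> \<tau> r) differentiable (at t within {0..}) \<Longrightarrow>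
      ((\<lambda>\<tau>. \<sigma> \<tau> r $ k $ i) has_real_derivative time_deriv \<sigma> t r $ k $ i) (at t within {0..})"
proof -
  assume "(\<lambda>\<tau>. v \<tau> r) differentiable (at t within {0..})"
  then have "((\<lambda>\<tau>. v \<tau> r) has_vector_derivative time_deriv v t r) (at t within {0..})"
    unfolding time_deriv_def by (simp add: vector_derivative_works)
  then show "((\<lambda>\<tau>. v \<tau> r $ i) has_real_derivative time_deriv v t r $ i) (at t within {0..})"
    unfolding has_real_derivative_iff_has_vector_derivative
    by (rule bounded_linear.has_vector_derivative[OF bounded_linear_vec_nth])
next
  assume "(\<lambda>\<tau>. \<sigma> \<tau> r) differentiable (at t within {0..})"
  then have "((\<lambda>\<tau>. \<sigma> \<tau> r) has_vector_derivative time_deriv \<sigma> t r) (at t within {0..})"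
    unfolding time_deriv_def by (simp add: vector_derivative_works)
  then show "((\<lambda>\<tau>. \<sigma> \<tau> r $ k $ i) has_real_derivative time_deriv \<sigma> t r $ k $ i) (at t within {0..})"
    unfolding has_real_derivative_iff_has_vector_derivative
    by (intro bounded_linear.has_vector_derivative[OF bounded_linear_vec_nth])
qed

text \<open>
  Componentwise, the energy is a sum of integrals to which
  \<open>has_derivative_weighted_integral\<close> applies.
\<close>

lemma el_energy_expand:
  fixes D :: "('d::finite, 's::finite, 'e, 'q, 'z) dg_scheme"
  assumes ok: "spaces_ok D" and e: "e \<in> elems D"
    and v: "v \<in> vec_fields D e" and \<sigma>: "\<sigma> \<in> sym_fields D e"
  shows "el_energy D e v \<sigma> =
      1 / 2 * ((\<Sum>i\<in>UNIV. \<integral>r. jac D e r * density D (el_map D e r) * v r $ i * v r $ i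
                 \<partial>lebesgue_on (ref_el D e))
        + (\<Sum>i\<in>UNIV. \<Sum>j\<in>UNIV. \<Sum>k\<in>UNIV. \<Sum>l\<in>UNIV.
             \<integral>r. jac D e r * compliance D (el_map D e r) i j k l * \<sigma> r $ i $ j * \<sigma> r $ k $ l
                 \<partial>lebesgue_on (ref_el D e)))"
proof -
  have int: "integrable (lebesgue_on (ref_el D e))
        (\<lambda>r. jac D e r * density D (el_map D e r) * v r $ i * v r $ i)"
    "integrable (lebesgue_on (ref_el D e))
        (\<lambda>r. jac D e r * compliance D (el_map D e r) i j k l * \<sigma> r $ i $ j * \<sigma> r $ k $ l)"
    for i j k l
  proof -
    have "(\<lambda>r. v r $ i) \<in> el_space D e" "(\<lambda>r. \<sigma> r $ i $ j) \<in> el_space D e" for i j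
      using v \<sigma> unfolding vec_fields_def sym_fields_def by blast+
    with ok e show "integrable (lebesgue_on (ref_el D e))
        (\<lambda>r. jac D e r * density D (el_map D e r) * v r $ i * v r $ i)"
      "integrable (lebesgue_on (ref_el D e))
        (\<lambda>r. jac D e r * compliance D (el_map D e r) i j k l * \<sigma> r $ i $ j * \<sigma> r $ k $ l)"
      unfolding spaces_ok_def by auto
  qed
  have "el_energy D e v \<sigma> =
     (\<integral>r. 1 / 2 * ((\<Sum>i\<in>UNIV. jac D e r * density D (el_map D e r) * v r $ i * v r $ i)
        + (\<Sum>i\<in>UNIV. \<Sum>j\<in>UNIV. \<Sum>k\<in>UNIV. \<Sum>l\<in>UNIV.
             jac D e r * compliance D (el_map D e r) i j k l * \<sigma> r $ i $ j * \<sigma> r $ k $ l))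
         \<partial>lebesgue_on (ref_el D e))"
    unfolding el_energy_def inner_vec_def
    by (intro Bochner_Integration.integral_cong refl)
       (simp add: sum_distrib_left distrib_left mult_ac)
  also have "\<dots> = 1 / 2 * ((\<Sum>i\<in>UNIV. \<integral>r. jac D e r * density D (el_map D e r) * v r $ i * v r $ i
                 \<partial>lebesgue_on (ref_el D e))
        + (\<Sum>i\<in>UNIV. \<Sum>j\<in>UNIV. \<Sum>k\<in>UNIV. \<Sum>l\<in>UNIV.
             \<integral>r. jac D e r * compliance D (el_map D e r) i j k l * \<sigma> r $ i $ j * \<sigma> r $ k $ l
                 \<partial>lebesgue_on (ref_el D e)))"
    using int by (simp add: Bochner_Integration.integral_sum)
  finally show ?thesis .
qed

text \<open>
  The product rule yields every term twice, which cancels the factor 1/2 of the energy and leaves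
  the left-hand sides of the two equations of the method, tested with the solution.  For the elastic
  part the two terms agree only after exchanging \<open>ij\<close> with \<open>kl\<close>.
\<close>

lemma el_energy_has_derivative:
  fixes D :: "('d::finite, 's::finite, 'e, 'q, 'z) dg_scheme"
  assumes ok: "dg_ok D" and sol: "dg_solution D F v \<sigma>" and e: "e \<in> elems D" and t: "t \<ge> 0"
  shows "((\<lambda>\<tau>. el_energy D e (v e \<tau>) (\<sigma> e \<tau>)) has_real_derivative
      (\<integral>r. jac D e r * density D (el_map D e r) * (v e t r \<bullet> time_deriv (v e) t r)
          \<partial>lebesgue_on (ref_el D e))
    + (\<integral>r. jac D e r * (\<Sum>i\<in>UNIV. \<Sum>j\<in>UNIV. \<Sum>k\<in>UNIV. \<Sum>l\<in>UNIV.
            \<sigma> e t r $ i $ j * compliance D (el_map D e r) i j k l * time_deriv (\<sigma> e) t r $ k $ l)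
          \<partial>lebesgue_on (ref_el D e))) (at t within {0..})"
proof -
  let ?M = "lebesgue_on (ref_el D e)"
  let ?v' = "time_deriv (v e) t" and ?\<sigma>' = "time_deriv (\<sigma> e) t"
  let ?\<rho> = "\<lambda>r. jac D e r * density D (el_map D e r)"
  let ?S = "\<lambda>i j k l r. jac D e r * compliance D (el_map D e r) i j k l"
  have fields: "v e \<tau> \<in> vec_fields D e" "\<sigma> e \<tau> \<in> sym_fields D e" if "\<tau> \<ge> 0" for \<tau>
    using sol e that unfolding dg_solution_def by blast+
  have diff: "(\<lambda>\<tau>. v e \<tau> r) differentiable (at t within {0..})"
    "(\<lambda>\<tau>. \<sigma> e \<tau> r) differentiable (at t within {0..})" for r
    using sol e t unfolding dg_solution_def by blast+
  have spaces: "spaces_ok D" and V: "fin_dim_space_on (ref_el D e) (el_space D e)"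
    using ok e unfolding dg_ok_def spaces_ok_def by blast+
  have int: "integrable ?M (\<lambda>r. ?\<rho> r * f r * g r)" "integrable ?M (\<lambda>r. ?S i j k l r * f r * g r)"
    if "f \<in> el_space D e" "g \<in> el_space D e" for f g i j k l
    using spaces e that unfolding spaces_ok_def by blast+
  have vV: "(\<lambda>r. v e \<tau> r $ i) \<in> el_space D e" and \<sigma>V: "(\<lambda>r. \<sigma> e \<tau> r $ i $ j) \<in> el_space D e"
    if "\<tau> \<ge> 0" for \<tau> i j
    using fields[OF that] unfolding vec_fields_def sym_fields_def by blast+
  have v': "((\<lambda>\<tau>. v e \<tau> r $ i) has_real_derivative ?v' r $ i) (at t within {0..})"
    for r i
    using diff(1)[of r] by (rule has_time_derivative_components(1))
  have \<sigma>': "((\<lambda>\<tau>. \<sigma> e \<tau> r $ i $ j) has_real_derivative ?\<sigma>' r $ i $ j) (at t within {0..})"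
    for r i j
    using diff(2)[of r] by (rule has_time_derivative_components(2))
  have v: "((\<lambda>\<tau>. \<integral>r. ?\<rho> r * v e \<tau> r $ i * v e \<tau> r $ i \<partial>?M) has_real_derivative
      (\<integral>r. ?\<rho> r * ?v' r $ i * v e t r $ i \<partial>?M) + (\<integral>r. ?\<rho> r * v e t r $ i * ?v' r $ i \<partial>?M))
        (at t within {0..})"
    "integrable ?M (\<lambda>r. ?\<rho> r * v e t r $ i * ?v' r $ i)" for i
    by (rule has_derivative_weighted_integral[OF V int(1) _ _ v' v' t]; simp add: vV)+
  have \<sigma>: "((\<lambda>\<tau>. \<integral>r. ?S i j k l r * \<sigma> e \<tau> r $ i' $ j' * \<sigma> e \<tau> r $ k' $ l' \<partial>?M)
      has_real_derivative
        (\<integral>r. ?S i j k l r * ?\<sigma>' r $ i' $ j' * \<sigma> e t r $ k' $ l' \<partial>?M)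
      + (\<integral>r. ?S i j k l r * \<sigma> e t r $ i' $ j' * ?\<sigma>' r $ k' $ l' \<partial>?M)) (at t within {0..})"
    "integrable ?M (\<lambda>r. ?S i j k l r * ?\<sigma>' r $ i' $ j' * \<sigma> e t r $ k' $ l')"
    "integrable ?M (\<lambda>r. ?S i j k l r * \<sigma> e t r $ i' $ j' * ?\<sigma>' r $ k' $ l')"
    for i j k l i' j' k' l'
    by (rule has_derivative_weighted_integral[OF V int(2) _ _ \<sigma>' \<sigma>' t]; simp add: \<sigma>V)+
  have S_sym: "AE r in ?M. compliance D (el_map D e r) i j k l = compliance D (el_map D e r) k l i j"
    for i j k l
  proof (rule AE_mp[OF AE_el_map_in_region])
    show "mesh_ok D" using ok by (simp add: dg_ok_def)
    show "AE r in ?M. el_map D e r \<in> region D \<longrightarrow>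
        compliance D (el_map D e r) i j k l = compliance D (el_map D e r) k l i j"
      using ok unfolding dg_ok_def material_ok_def by blast
  qed fact
  have stress_sym: "(\<integral>r. ?S i j k l r * ?\<sigma>' r $ i $ j * \<sigma> e t r $ k $ l \<partial>?M)
      = (\<integral>r. ?S k l i j r * \<sigma> e t r $ k $ l * ?\<sigma>' r $ i $ j \<partial>?M)" for i j k l
    by (rule integral_cong_AE)
       (use S_sym[of i j k l] \<sigma>(2)[of i j k l i j k l] \<sigma>(3)[of k l i j k l i j] in
         \<open>auto intro: borel_measurable_integrable elim!: AE_mp simp: mult_ac\<close>)
  let ?dv = "(\<Sum>i\<in>UNIV. (\<integral>r. ?\<rho> r * ?v' r $ i * v e t r $ i \<partial>?M)
                           + (\<integral>r. ?\<rho> r * v e t r $ i * ?v' r $ i \<partial>?M))"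
  let ?d\<sigma> = "(\<Sum>i\<in>UNIV. \<Sum>j\<in>UNIV. \<Sum>k\<in>UNIV. \<Sum>l\<in>UNIV.
                 (\<integral>r. ?S i j k l r * ?\<sigma>' r $ i $ j * \<sigma> e t r $ k $ l \<partial>?M)
               + (\<integral>r. ?S i j k l r * \<sigma> e t r $ i $ j * ?\<sigma>' r $ k $ l \<partial>?M))"
  have deriv: "((\<lambda>\<tau>. el_energy D e (v e \<tau>) (\<sigma> e \<tau>)) has_real_derivative 1 / 2 * (?dv + ?d\<sigma>))
      (at t within {0..})"
  proof (rule has_field_derivative_transform_within[where d = 1])
    show "((\<lambda>\<tau>. 1 / 2 * ((\<Sum>i\<in>UNIV. \<integral>r. ?\<rho> r * v e \<tau> r $ i * v e \<tau> r $ i \<partial>?M)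
        + (\<Sum>i\<in>UNIV. \<Sum>j\<in>UNIV. \<Sum>k\<in>UNIV. \<Sum>l\<in>UNIV.
             \<integral>r. ?S i j k l r * \<sigma> e \<tau> r $ i $ j * \<sigma> e \<tau> r $ k $ l \<partial>?M)))
       has_real_derivative 1 / 2 * (?dv + ?d\<sigma>)) (at t within {0..})"
      by (intro DERIV_cmult DERIV_add DERIV_sum v(1) \<sigma>(1))
  qed (use t el_energy_expand[OF spaces e fields] in auto)
  have "?dv = 2 * (\<Sum>i\<in>UNIV. \<integral>r. ?\<rho> r * v e t r $ i * ?v' r $ i \<partial>?M)"
    by (simp add: sum_distrib_left mult_ac)
  also have "(\<Sum>i\<in>UNIV. \<integral>r. ?\<rho> r * v e t r $ i * ?v' r $ i \<partial>?M)
      = (\<integral>r. ?\<rho> r * (v e t r \<bullet> ?v' r) \<partial>?M)"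
    by (subst Bochner_Integration.integral_sum[symmetric])
       (use v(2) in \<open>auto simp: inner_vec_def sum_distrib_left mult_ac\<close>)
  finally have dv: "?dv = 2 * (\<integral>r. ?\<rho> r * (v e t r \<bullet> ?v' r) \<partial>?M)" .
  let ?Q = "\<lambda>i j k l. \<integral>r. ?S i j k l r * \<sigma> e t r $ i $ j * ?\<sigma>' r $ k $ l \<partial>?M"
  have swap: "(\<Sum>i\<in>UNIV. \<Sum>j\<in>UNIV. \<Sum>k\<in>UNIV. \<Sum>l\<in>UNIV. ?Q k l i j)
      = (\<Sum>i\<in>UNIV. \<Sum>j\<in>UNIV. \<Sum>k\<in>UNIV. \<Sum>l\<in>UNIV. ?Q i j k l)"
  proof -
    have "(\<Sum>(i, j)\<in>UNIV \<times> UNIV. \<Sum>(k, l)\<in>UNIV \<times> UNIV. ?Q k l i j)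
        = (\<Sum>(k, l)\<in>UNIV \<times> UNIV. \<Sum>(i, j)\<in>UNIV \<times> UNIV. ?Q k l i j)"
      unfolding case_prod_unfold by (rule sum.swap)
    then show ?thesis by (simp only: sum.cartesian_product[symmetric])
  qed
  have "?d\<sigma> = 2 * (\<Sum>i\<in>UNIV. \<Sum>j\<in>UNIV. \<Sum>k\<in>UNIV. \<Sum>l\<in>UNIV. ?Q i j k l)"
    unfolding stress_sym by (simp only: sum.distrib swap mult_2)
  also have "(\<Sum>i\<in>UNIV. \<Sum>j\<in>UNIV. \<Sum>k\<in>UNIV. \<Sum>l\<in>UNIV. ?Q i j k l)
      = (\<integral>r. (\<Sum>i\<in>UNIV. \<Sum>j\<in>UNIV. \<Sum>k\<in>UNIV. \<Sum>l\<in>UNIV.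
            ?S i j k l r * \<sigma> e t r $ i $ j * ?\<sigma>' r $ k $ l) \<partial>?M)"
    using \<sigma>(3) by (simp add: Bochner_Integration.integral_sum)
  also have "\<dots> = (\<integral>r. jac D e r * (\<Sum>i\<in>UNIV. \<Sum>j\<in>UNIV. \<Sum>k\<in>UNIV. \<Sum>l\<in>UNIV.
            \<sigma> e t r $ i $ j * compliance D (el_map D e r) i j k l * ?\<sigma>' r $ k $ l) \<partial>?M)"
    by (intro Bochner_Integration.integral_cong refl) (simp add: sum_distrib_left mult_ac)
  finally show ?thesis using deriv dv by (simp add: algebra_simps)
qed

text \<open>
  The integrand of the power that element \<open>e\<close> receives through the mortar element \<open>m\<close>: the
  mortar terms of both equations of the method, tested with the solution.
\<close>

definition mortar_power :: "('d::finite, 's::finite, 'e, 'q, 'z) dg_scheme \<Rightarrow> ('s, 'q) num_flux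
    \<Rightarrow> ('e \<Rightarrow> real^'d \<Rightarrow> real^3) \<Rightarrow> ('e \<Rightarrow> real^'d \<Rightarrow> real^3^3) \<Rightarrow> 'q \<Rightarrow> 'e \<Rightarrow> real^'s \<Rightarrow> real" where
  "mortar_power D F v \<sigma> m e s =
     surf_jac D m s * (proj_vec D m e (v e) s \<bullet> T_star_el D F v \<sigma> m e s)
   + surf_jac D m s * (traction D m e (\<sigma> e) s \<bullet> (v_star D F v \<sigma> m s - v_side D v m e s))"

text \<open>
  The volume integrals cancel: the velocity equation carries \<open>- \<sigma>\<^sub>i\<^sub>j \<partial>\<^sub>j v\<^sub>i\<close>, the stress equation
  the product of \<open>\<sigma>\<close> with the symmetrized gradient, and since \<open>\<sigma>\<close> is symmetric the two volume
  integrands are pointwise opposite.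
\<close>

lemma el_power_balance:
  fixes D :: "('d::finite, 's::finite, 'e, 'q, 'z) dg_scheme"
  assumes sol: "dg_solution D F v \<sigma>" and e: "e \<in> elems D" and t: "t \<ge> 0"
  shows "(\<integral>r. jac D e r * density D (el_map D e r) * (v e t r \<bullet> time_deriv (v e) t r)
          \<partial>lebesgue_on (ref_el D e))
    + (\<integral>r. jac D e r * (\<Sum>i\<in>UNIV. \<Sum>j\<in>UNIV. \<Sum>k\<in>UNIV. \<Sum>l\<in>UNIV.
            \<sigma> e t r $ i $ j * compliance D (el_map D e r) i j k l * time_deriv (\<sigma> e) t r $ k $ l)
          \<partial>lebesgue_on (ref_el D e))
    = (\<Sum>m\<in>mortars_of D e.
        \<integral>s. mortar_power D F (\<lambda>e. v e t) (\<lambda>e. \<sigma> e t) m e s \<partial>lebesgue_on (ref_mo D m))"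
    and "m \<in> mortars_of D e \<Longrightarrow> integrable (lebesgue_on (ref_mo D m))
        (mortar_power D F (\<lambda>e. v e t) (\<lambda>e. \<sigma> e t) m e)"
proof -
  have fields: "v e t \<in> vec_fields D e" "\<sigma> e t \<in> sym_fields D e"
    and flux: "flux_integrals_exist D F v \<sigma> e t"
    and eqs: "velocity_eq D F v \<sigma> e t (v e t)" "stress_eq D F v \<sigma> e t (\<sigma> e t)"
    using sol e t unfolding dg_solution_def by blast+
  have int: "integrable (lebesgue_on (ref_mo D m)) (\<lambda>s. surf_jac D m s *
             (proj_vec D m e (v e t) s \<bullet> T_star_el D F (\<lambda>e. v e t) (\<lambda>e. \<sigma> e t) m e s))"
    "integrable (lebesgue_on (ref_mo D m)) (\<lambda>s. surf_jac D m s *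
             (traction D m e (\<sigma> e t) s \<bullet>
                (v_star D F (\<lambda>e. v e t) (\<lambda>e. \<sigma> e t) m s - v_side D (\<lambda>e. v e t) m e s)))"
    if "m \<in> mortars_of D e" for m
    using flux fields that unfolding flux_integrals_exist_def by blast+
  show "integrable (lebesgue_on (ref_mo D m)) (mortar_power D F (\<lambda>e. v e t) (\<lambda>e. \<sigma> e t) m e)"
    if "m \<in> mortars_of D e"
    unfolding mortar_power_def[abs_def] using int[OF that] by (rule Bochner_Integration.integrable_add)
  have sym: "\<sigma> e t r $ i $ j = \<sigma> e t r $ j $ i" for r i j
    using fields(2) unfolding sym_fields_def by blast
  have "(\<Sum>i\<in>UNIV. \<Sum>j\<in>UNIV. \<sigma> e t r $ i $ j * pd D e i (\<lambda>r. v e t r $ j) r)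
      = (\<Sum>i\<in>UNIV. \<Sum>j\<in>UNIV. \<sigma> e t r $ i $ j * pd D e j (\<lambda>r. v e t r $ i) r)" for r
    by (subst sum.swap) (intro sum.cong refl, subst sym, rule refl)
  then have strain: "jac D e r / 2 * (\<Sum>i\<in>UNIV. \<Sum>j\<in>UNIV. \<sigma> e t r $ i $ j *
              (pd D e j (\<lambda>r. v e t r $ i) r + pd D e i (\<lambda>r. v e t r $ j) r))
      = jac D e r * (\<Sum>i\<in>UNIV. \<Sum>j\<in>UNIV. pd D e j (\<lambda>r. v e t r $ i) r * \<sigma> e t r $ i $ j)" for r
    by (simp add: distrib_left sum.distrib mult.commute)
  show "(\<integral>r. jac D e r * density D (el_map D e r) * (v e t r \<bullet> time_deriv (v e) t r)
          \<partial>lebesgue_on (ref_el D e))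
    + (\<integral>r. jac D e r * (\<Sum>i\<in>UNIV. \<Sum>j\<in>UNIV. \<Sum>k\<in>UNIV. \<Sum>l\<in>UNIV.
            \<sigma> e t r $ i $ j * compliance D (el_map D e r) i j k l * time_deriv (\<sigma> e) t r $ k $ l)
          \<partial>lebesgue_on (ref_el D e))
    = (\<Sum>m\<in>mortars_of D e.
        \<integral>s. mortar_power D F (\<lambda>e. v e t) (\<lambda>e. \<sigma> e t) m e s \<partial>lebesgue_on (ref_mo D m))"
    unfolding eqs(1)[unfolded velocity_eq_def] eqs(2)[unfolded stress_eq_def] strain mortar_power_def
    using int by (simp add: sum.distrib)
qed

text \<open>
  The flux values \<open>T\<^sup>*\<close> and \<open>v\<^sup>*\<close> and the one-sided velocity are common to all elements on the same side
  of the mortar element, so summing there replaces the projected traces by the mortar states;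
  on the plus side both \<open>T\<^sup>*\<close> and the traction enter with reversed sign.
\<close>

lemma mortar_power_sum:
  fixes D :: "('d::finite, 's::finite, 'e, 'q, 'z) dg_scheme"
  assumes ok: "mesh_ok D" and m: "m \<in> mortars D"
  shows "(\<Sum>e\<in>elems_of D m. mortar_power D F v \<sigma> m e s) =
     surf_jac D m s *
       ((v_minus D v m s - v_plus D v m s) \<bullet> T_star D F v \<sigma> m s
        + v_star D F v \<sigma> m s \<bullet> (T_minus D \<sigma> m s - T_plus D \<sigma> m s)
        - v_minus D v m s \<bullet> T_minus D \<sigma> m s + v_plus D v m s \<bullet> T_plus D \<sigma> m s)"
proof -
  let ?Ts = "T_star D F v \<sigma> m s" and ?vs = "v_star D F v \<sigma> m s"
  have split: "elems_of D m = elems_minus D m \<union> elems_plus D m"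
    and disj: "elems_minus D m \<inter> elems_plus D m = {}"
    using ok m unfolding mesh_ok_def by blast+
  have "finite (elems_of D m)"
    using ok unfolding mesh_ok_def elems_of_def by simp
  then have fin: "finite (elems_minus D m)" "finite (elems_plus D m)"
    unfolding split by auto
  have "(\<Sum>e\<in>elems_minus D m. mortar_power D F v \<sigma> m e s)
      = (\<Sum>e\<in>elems_minus D m. surf_jac D m s * (proj_vec D m e (v e) s \<bullet> ?Ts)
          + surf_jac D m s * (traction D m e (\<sigma> e) s \<bullet> (?vs - v_minus D v m s)))"
    by (intro sum.cong) (auto simp: mortar_power_def T_star_el_def v_side_def)
  also have "\<dots> = surf_jac D m s *
      (v_minus D v m s \<bullet> ?Ts + T_minus D \<sigma> m s \<bullet> (?vs - v_minus D v m s))"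
    by (simp only: v_minus_def[of D v] T_minus_def sum.distrib sum_distrib_left[symmetric]
        inner_sum_left[symmetric] distrib_left)
  finally have minus: "(\<Sum>e\<in>elems_minus D m. mortar_power D F v \<sigma> m e s) = \<dots>" .
  have "(\<Sum>e\<in>elems_plus D m. mortar_power D F v \<sigma> m e s)
      = (\<Sum>e\<in>elems_plus D m. surf_jac D m s * (proj_vec D m e (v e) s \<bullet> (- ?Ts))
          + surf_jac D m s * (traction D m e (\<sigma> e) s \<bullet> (?vs - v_plus D v m s)))"
    using disj by (intro sum.cong) (auto simp: mortar_power_def T_star_el_def v_side_def)
  also have "\<dots> = surf_jac D m s *
      (v_plus D v m s \<bullet> (- ?Ts) + (- T_plus D \<sigma> m s) \<bullet> (?vs - v_plus D v m s))"
    by (simp only: v_plus_def[of D v] T_plus_def sum.distrib sum_distrib_left[symmetric]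
        inner_sum_left[symmetric] distrib_left minus_minus)
  finally have plus: "(\<Sum>e\<in>elems_plus D m. mortar_power D F v \<sigma> m e s) = \<dots>" .
  show ?thesis
    unfolding split sum.union_disjoint[OF fin disj] minus plus
    by (simp add: algebra_simps inner_diff_left inner_diff_right inner_commute)
qed

lemma elems_mortars_swap:
  assumes "mesh_ok D"
  shows "(\<Sum>e\<in>elems D. \<Sum>m\<in>mortars_of D e. f e m) = (\<Sum>m\<in>mortars D. \<Sum>e\<in>elems_of D m. f e m)"
  unfolding mortars_of_def elems_of_def
  by (rule sum.swap_restrict) (use assms in \<open>auto simp: mesh_ok_def\<close>)

theorem theorem2:
  fixes D :: "('d::finite, 's::finite, 'e, 'q) dg"
    and F :: "('s, 'q) num_flux"
    and v :: "'e \<Rightarrow> real \<Rightarrow> real^'d \<Rightarrow> real^3"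
    and \<sigma> :: "'e \<Rightarrow> real \<Rightarrow> real^'d \<Rightarrow> real^3^3"
    and t :: real
  assumes dim: "CARD('d) = 2 \<or> CARD('d) = 3" "CARD('s) + 1 = CARD('d)"
    and setting: "dg_ok D"
    and interior_flux: "\<And>m s vm vp Tm Tp.
          \<lbrakk>m \<in> mortars D; \<not> boundary_mortar D m; s \<in> ref_mo D m\<rbrakk> \<Longrightarrow>
          surf_jac D m s *
            ((vm - vp) \<bullet> T_int F m s vm vp Tm Tp + v_int F m s vm vp Tm Tp \<bullet> (Tm - Tp)
             - vm \<bullet> Tm + vp \<bullet> Tp) \<le> 0"
    and boundary_flux: "\<And>m s vm Tm.
          \<lbrakk>m \<in> mortars D; boundary_mortar D m; s \<in> ref_mo D m\<rbrakk> \<Longrightarrow>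
          surf_jac D m s *
            (vm \<bullet> T_bdry F m s vm Tm + v_bdry F m s vm Tm \<bullet> Tm - vm \<bullet> Tm) \<le> 0"
    and solution: "dg_solution D F v \<sigma>"
    and time: "t \<ge> 0"
  shows "energy D (\<lambda>e. v e t) (\<lambda>e. \<sigma> e t) \<le> energy D (\<lambda>e. v e 0) (\<lambda>e. \<sigma> e 0)"
proof -
  let ?E = "\<lambda>\<tau>. energy D (\<lambda>e. v e \<tau>) (\<lambda>e. \<sigma> e \<tau>)"
  let ?p = "\<lambda>\<tau>. mortar_power D F (\<lambda>e. v e \<tau>) (\<lambda>e. \<sigma> e \<tau>)"
  have mesh: "mesh_ok D"
    using setting by (simp add: dg_ok_def)
  have dissipative: "(\<Sum>e\<in>elems_of D m. ?p \<tau> m e s) \<le> 0"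
    if m: "m \<in> mortars D" and s: "s \<in> ref_mo D m" for m s \<tau>
  proof (cases "boundary_mortar D m")
    case True
    then have "elems_plus D m = {}"
      using mesh m unfolding mesh_ok_def by blast
    \<comment> \<open>The interior balance then covers the boundary case, with vanishing plus states.\<close>
    then have "v_plus D (\<lambda>e. v e \<tau>) m s = 0" "T_plus D (\<lambda>e. \<sigma> e \<tau>) m s = 0"
      by (simp_all add: v_plus_def T_plus_def)
    then show ?thesis
      unfolding mortar_power_sum[OF mesh m]
      using boundary_flux[OF m True s] True by (simp add: T_star_def v_star_def)
  next
    case False
    then show ?thesis
      unfolding mortar_power_sum[OF mesh m]
      using interior_flux[OF m False s] by (simp add: T_star_def v_star_def)
  qed
  have deriv: "\<exists>y. (?E has_real_derivative y) (at \<tau> within {0..}) \<and> y \<le> 0" if \<tau>: "\<tau> \<ge> 0" for \<tau>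
  proof (intro exI conjI)
    let ?P = "\<lambda>e m. \<integral>s. ?p \<tau> m e s \<partial>lebesgue_on (ref_mo D m)"
    show "(?E has_real_derivative (\<Sum>e\<in>elems D. \<Sum>m\<in>mortars_of D e. ?P e m)) (at \<tau> within {0..})"
      unfolding energy_def
      using el_energy_has_derivative[OF setting solution _ \<tau>]
        el_power_balance(1)[OF solution _ \<tau>]
      by (intro DERIV_sum) simp
    have "(\<Sum>e\<in>elems_of D m. ?P e m) \<le> 0" if m: "m \<in> mortars D" for m
    proof -
      have "integrable (lebesgue_on (ref_mo D m)) (?p \<tau> m e)" if "e \<in> elems_of D m" for e
        by (rule el_power_balance(2)[OF solution _ \<tau>])
           (use m that in \<open>auto simp: elems_of_def mortars_of_def\<close>)
      then have "(\<Sum>e\<in>elems_of D m. ?P e m)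
          = (\<integral>s. (\<Sum>e\<in>elems_of D m. ?p \<tau> m e s) \<partial>lebesgue_on (ref_mo D m))"
        by (simp add: Bochner_Integration.integral_sum)
      also have "\<dots> \<le> 0"
      proof -
        have "0 \<le> (\<integral>s. - (\<Sum>e\<in>elems_of D m. ?p \<tau> m e s) \<partial>lebesgue_on (ref_mo D m))"
          by (intro Bochner_Integration.integral_nonneg) (simp add: dissipative[OF m])
        then show ?thesis by simp
      qed
      finally show ?thesis .
    qed
    then show "(\<Sum>e\<in>elems D. \<Sum>m\<in>mortars_of D e. ?P e m) \<le> 0"
      unfolding elems_mortars_swap[OF mesh] by (rule sum_nonpos)
  qed
  show ?thesis
  proof (rule DERIV_nonpos_imp_decreasing_open[OF time])
    fix \<tau> :: real assume "0 < \<tau>" "\<tau> < t"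
    then have "at \<tau> within {0..} = at \<tau>"
      by (intro at_within_interior) simp
    then show "\<exists>y. (?E has_real_derivative y) (at \<tau>) \<and> y \<le> 0"
      using deriv[of \<tau>] \<open>0 < \<tau>\<close> by simp
  next
    have "continuous_on {0..} ?E"
      unfolding continuous_on_eq_continuous_within
    proof
      fix \<tau> :: real assume "\<tau> \<in> {0..}"
      then obtain y where "(?E has_real_derivative y) (at \<tau> within {0..})"
        using deriv[of \<tau>] by auto
      then show "continuous (at \<tau> within {0..}) ?E"
        by (rule DERIV_continuous)
    qed
    then show "continuous_on {0..t} ?E"
      by (rule continuous_on_subset) auto
  qed
qed

end
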